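(* Let $M\ge1$ be an integer. For every $m\ge0$, $$f_m^{[M]}(t)=(-1)^m q_m(1,t,\ldots,t^{M-1}).$$ In particular, $(-1)^m f_m^{[M]}(t)\in\mathbb{N}[t]$. Moreover, $$(-1)^m f_m^{[M]}(t)=\sum_{a=0}^{\min(M,m)}t^{\binom a2}\begin{bmatrix} M \\ a \end{bmatrix}_t\begin{bmatrix} M+m-a-1 \\ m-a \end{bmatrix}_t.$$
   Context: Let $t$ be an indeterminate. The coefficients $f_m^{[M]}(t)$ are defined by $F_{t,t^M}(u)=\sum_{m\ge0}f_m^{[M]}(t)u^m$, where $$F_{t,s}(u)=\exp\Big(-2\sum_{n\ge1,\ n\text{ odd}}\frac{1-s^n}{1-t^n}\frac{u^n}{n}\Big)$$ as a formal power series in $u$. The one-row Schur $Q$-function $q_m$ in variables $x_1,\ldots,x_M$ is defined by $\sum_{m\ge0}q_m(x_1,\ldots,x_M)z^m=\prod_{i=1}^M\frac{1+x_iz}{1-x_iz}$. $\begin{bmatrix} n \\ k \end{bmatrix}_t$ is the Gaussian binomial coefficient in $t$, and $\mathbb{N}[t]$ denotes polynomials with nonnegative integer coefficients. *)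

theory Defs
  imports "HOL-Computational_Algebra.Computational_Algebra"
begin

text \<open>
  The indeterminate \<open>t\<close> lives in the field of rational functions over the rationals,
  i.e. the fraction field of \<open>rat poly\<close>; \<open>1 - t ^ n\<close> is then invertible for all \<open>n \<ge> 1\<close>.
\<close>

definition indet :: "rat poly fract"
  where "indet = to_fract (monom 1 1)"

text \<open>
  The series \<open>F\<^bsub>t,s\<^esub>(u)\<close>. Substitution into the exponential series is formal
  composition, which is meaningful because the inner series has constant term 0.
\<close>

definition F_series :: "'a \<Rightarrow> 'a \<Rightarrow> 'a :: field_char_0 fps"
  where "F_series t s =
    fps_exp 1 oo
      (- 2 * Abs_fps (\<lambda>n. if odd n then (1 - s ^ n) / (1 - t ^ n) * (1 / of_nat n) else 0))"

definition f_coeff :: "nat \<Rightarrow> nat \<Rightarrow> rat poly fract"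
  where "f_coeff M m = fps_nth (F_series indet (indet ^ M)) m"

text \<open>
  The value \<open>q\<^sub>m(x\<^sub>1, \<dots>, x\<^sub>M)\<close> of the one-row Schur \<open>Q\<close>-function at field elements
  \<open>x 1\<close>, ..., \<open>x M\<close>; the other values of \<open>x\<close> are irrelevant.
\<close>

definition schur_q :: "nat \<Rightarrow> nat \<Rightarrow> (nat \<Rightarrow> 'a) \<Rightarrow> 'a :: field"
  where "schur_q m M x =
    fps_nth (\<Prod>i=1..M. (1 + fps_const (x i) * fps_X) / (1 - fps_const (x i) * fps_X)) m"

text \<open>The denominators vanish only if \<open>t\<close> is a root of unity, so not for \<open>t = indet\<close>.\<close>

definition gauss_binomial :: "'a \<Rightarrow> nat \<Rightarrow> nat \<Rightarrow> 'a :: field"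
  where "gauss_binomial t n k =
    (if k \<le> n then \<Prod>i<k. (1 - t ^ (n - i)) / (1 - t ^ (i + 1)) else 0)"

text \<open>\<open>\<nat>[t]\<close> as a subset of the field of rational functions.\<close>

definition nat_polys :: "rat poly fract set"
  where "nat_polys = {to_fract p | p. \<forall>i. coeff p i \<in> \<nat>}"

end

theory Submission
  imports Defs
begin

text \<open>
  For \<open>n \<ge> 1\<close> the quotient \<open>(1 - t\<^sup>M\<^sup>n) / (1 - t\<^sup>n)\<close> is the power sum
  \<open>\<Sum>i<M. (t\<^sup>i)\<^sup>n\<close>. Hence the exponent of \<open>F_series t (t ^ M)\<close>, with \<open>u\<close> replaced by
  \<open>- u\<close>, is the sum over \<open>i < M\<close> of \<open>2 * (\<Sum>n odd. (t\<^sup>i u)\<^sup>n / n)\<close>, which is the logarithm of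
  \<open>(1 + t\<^sup>i u) / (1 - t\<^sup>i u)\<close>. So \<open>F_series t (t ^ M)\<close> at \<open>- u\<close> is the generating function of
  the \<open>q\<^sub>m(1, t, \<dots>, t\<^sup>M\<^sup>-\<^sup>1)\<close> (\<open>F_series_nth_eq_schur_q\<close>). No formal logarithm is needed: the
  exponential of \<open>L\<close> is the only series with constant term 1 and logarithmic derivative \<open>L'\<close>
  (\<open>fps_exp_compose_unique\<close>), and logarithmic derivatives add up over products.

  The explicit formula is the Cauchy product of the two \<open>q\<close>-binomial theorems with base \<open>t\<close>,
  for \<open>\<Prod>i<M. 1 + t\<^sup>i u\<close> and for \<open>\<Prod>i<M. 1 / (1 - t\<^sup>i u)\<close>; both are proved by induction on
  \<open>M\<close> from the same Pascal rule (\<open>gauss_binomial_pascal\<close>). The Pascal rule also shows that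
  Gaussian binomials are polynomials with nonnegative integer coefficients, and nonnegativity
  of \<open>(- 1) ^ m * f_coeff M m\<close> can then be read off the formula.

  Everything except nonnegativity is proved for any \<open>t\<close> in a field of characteristic 0 that is
  not a root of unity.
\<close>

section \<open>Gaussian binomial coefficients\<close>

lemma gauss_binomial_0_right [simp]: "gauss_binomial t n 0 = 1"
  by (simp add: gauss_binomial_def)

lemma gauss_binomial_eq_0 [simp]: "n < k \<Longrightarrow> gauss_binomial t n k = 0"
  by (simp add: gauss_binomial_def)

lemma gauss_binomial_pascal:
  fixes t :: "'a :: field"
  assumes t: "\<And>j. j > 0 \<Longrightarrow> t ^ j \<noteq> 1"
  shows "gauss_binomial t (Suc n) (Suc k) =
           gauss_binomial t n (Suc k) + t ^ (n - k) * gauss_binomial t n k"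
proof (cases "k \<le> n")
  case True
  have nz: "1 - t ^ Suc j \<noteq> 0" for j
    using t[of "Suc j"] by simp
  have "gauss_binomial t (Suc n) (Suc k) =
      (\<Prod>i<Suc k. 1 - t ^ (Suc n - i)) / (\<Prod>i<Suc k. 1 - t ^ Suc i)"
    using True by (simp add: gauss_binomial_def prod_dividef del: prod.lessThan_Suc)
  also have "(\<Prod>i<Suc k. 1 - t ^ (Suc n - i)) = (1 - t ^ Suc n) * (\<Prod>i<k. 1 - t ^ (n - i))"
    by (subst prod.lessThan_Suc_shift) simp
  also have "\<dots> / (\<Prod>i<Suc k. 1 - t ^ Suc i) =
      gauss_binomial t n k * (1 - t ^ Suc n) / (1 - t ^ Suc k)"
    using True by (simp add: gauss_binomial_def prod_dividef)
  finally have up: "gauss_binomial t (Suc n) (Suc k) =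
      gauss_binomial t n k * (1 - t ^ Suc n) / (1 - t ^ Suc k)" .
  have right: "gauss_binomial t n (Suc k) =
      gauss_binomial t n k * (1 - t ^ (n - k)) / (1 - t ^ Suc k)"
    using True by (cases "k = n") (simp_all add: gauss_binomial_def)
  have "t ^ Suc n = t ^ (n - k) * t ^ Suc k"
    using True by (simp flip: power_add)
  then have "gauss_binomial t n k * (1 - t ^ Suc n) =
      gauss_binomial t n k * (1 - t ^ (n - k)) + t ^ (n - k) * gauss_binomial t n k * (1 - t ^ Suc k)"
    by (simp add: algebra_simps del: power_Suc)
  then show ?thesis
    unfolding up right using nz[of k] by (simp add: add_divide_distrib del: power_Suc)
qed simp_all

section \<open>The \<open>q\<close>-binomial theorems\<close>

text \<open>
  Multiplication by the factor \<open>1 + t\<^sup>M u\<close> adds \<open>t\<^sup>M\<close> times the coefficient at \<open>a\<close> to the one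
  at \<open>a + 1\<close>. Since \<open>t\<^sup>M = t\<^sup>a t\<^sup>M\<^sup>-\<^sup>a\<close> and \<open>(a + 1 choose 2) = a + (a choose 2)\<close>, this is the
  Pascal rule.
\<close>

lemma prod_one_plus_geometric:
  fixes t :: "'a :: field"
  assumes t: "\<And>j. j > 0 \<Longrightarrow> t ^ j \<noteq> 1"
  shows "(\<Prod>i<M. 1 + fps_const (t ^ i) * fps_X) =
           Abs_fps (\<lambda>a. t ^ (a choose 2) * gauss_binomial t M a)"
proof (induction M)
  case 0
  show ?case
    by (rule fps_ext) (simp add: numeral_2_eq_2)
next
  case (Suc M)
  show ?case
  proof (rule fps_ext)
    fix n
    show "(\<Prod>i<Suc M. 1 + fps_const (t ^ i) * fps_X) $ n =
        Abs_fps (\<lambda>a. t ^ (a choose 2) * gauss_binomial t (Suc M) a) $ n"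
    proof (cases n)
      case (Suc a)
      \<comment> \<open>For \<open>a > M\<close> the exponent \<open>M - a\<close> is truncated to 0, but then the Gaussian binomial vanishes.\<close>
      have eq: "t ^ M * gauss_binomial t M a = t ^ a * (t ^ (M - a) * gauss_binomial t M a)"
        by (cases "a \<le> M") (simp_all flip: power_add mult.assoc)
      have choose: "Suc a choose 2 = a + (a choose 2)"
        by (simp add: numeral_2_eq_2)
      let ?P = "\<Prod>i<M. 1 + fps_const (t ^ i) * fps_X"
      have "(\<Prod>i<Suc M. 1 + fps_const (t ^ i) * fps_X) = ?P + fps_X * (fps_const (t ^ M) * ?P)"
        by (simp add: distrib_right mult_ac)
      then have "(\<Prod>i<Suc M. 1 + fps_const (t ^ i) * fps_X) $ n = ?P $ Suc a + t ^ M * ?P $ a"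
        using Suc by simp
      also have "\<dots> = t ^ a * t ^ (a choose 2) * gauss_binomial t M (Suc a) +
          t ^ (a choose 2) * (t ^ M * gauss_binomial t M a)"
        by (simp add: Suc.IH choose power_add)
      also have "\<dots> = t ^ a * t ^ (a choose 2) * gauss_binomial t (Suc M) (Suc a)"
        by (simp add: eq gauss_binomial_pascal[OF t] distrib_left mult_ac)
      finally show ?thesis
        using Suc choose by (simp add: power_add)
    qed (simp add: Suc.IH fps_mult_nth)
  qed
qed

text \<open>
  At \<open>M = 0\<close> the truncated subtraction gives the correct empty product: the coefficient is 1
  at \<open>k = 0\<close>, and \<open>gauss_binomial t (k - 1) k = 0\<close> for \<open>k > 0\<close>.
\<close>

lemma prod_inverse_one_minus_geometric:
  fixes t :: "'a :: field"
  assumes t: "\<And>j. j > 0 \<Longrightarrow> t ^ j \<noteq> 1"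
  shows "(\<Prod>i<M. inverse (1 - fps_const (t ^ i) * fps_X)) =
           Abs_fps (\<lambda>k. gauss_binomial t (M + k - 1) k)"
proof (induction M)
  case 0
  show ?case
  proof (rule fps_ext)
    fix n
    show "(\<Prod>i<0. inverse (1 - fps_const (t ^ i) * fps_X)) $ n =
        Abs_fps (\<lambda>k. gauss_binomial t (0 + k - 1) k) $ n"
      by (cases n) simp_all
  qed
next
  case (Suc M)
  let ?d = "1 - fps_const (t ^ M) * fps_X"
  \<comment> \<open>At index \<open>k + 1\<close>, \<open>?H (Suc M) * ?d = ?H M\<close> is the Pascal rule with \<open>n = M + k\<close>.\<close>
  let ?H = "\<lambda>M. Abs_fps (\<lambda>k. gauss_binomial t (M + k - 1) k)"
  have "?H (Suc M) * ?d = ?H M"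
  proof (rule fps_ext)
    fix n
    show "(?H (Suc M) * ?d) $ n = ?H M $ n"
      by (cases n) (simp_all add: gauss_binomial_pascal[OF t] algebra_simps)
  qed
  then have "?H M * inverse ?d = ?H (Suc M) * (?d * inverse ?d)"
    by (simp add: mult.assoc)
  also have "?d * inverse ?d = 1"
    by (simp add: inverse_mult_eq_1')
  finally show ?case
    by (simp add: Suc.IH)
qed

text \<open>The products are indexed by \<open>i < M\<close> above and by \<open>1 \<le> i \<le> M\<close> in \<open>schur_q\<close>.\<close>

lemma schur_q_geometric:
  fixes t :: "'a :: field"
  assumes t: "\<And>j. j > 0 \<Longrightarrow> t ^ j \<noteq> 1"
  shows "schur_q m M (\<lambda>i. t ^ (i - 1)) =
           (\<Sum>a=0..min M m. t ^ (a choose 2) * gauss_binomial t M a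
              * gauss_binomial t (M + m - a - 1) (m - a))"
proof -
  have "(\<Prod>i=1..M. (1 + fps_const (t ^ (i - 1)) * fps_X) / (1 - fps_const (t ^ (i - 1)) * fps_X))
      = (\<Prod>i<M. (1 + fps_const (t ^ i) * fps_X) * inverse (1 - fps_const (t ^ i) * fps_X))"
    by (rule prod.reindex_bij_witness[of _ Suc "\<lambda>i. i - 1"]) (auto simp: fps_divide_unit)
  then have "schur_q m M (\<lambda>i. t ^ (i - 1)) =
      (\<Sum>a=0..m. t ^ (a choose 2) * gauss_binomial t M a * gauss_binomial t (M + (m - a) - 1) (m - a))"
    by (simp add: schur_q_def prod.distrib prod_one_plus_geometric[OF t]
        prod_inverse_one_minus_geometric[OF t] fps_mult_nth)
  also have "\<dots> = (\<Sum>a=0..min M m. t ^ (a choose 2) * gauss_binomial t M a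
      * gauss_binomial t (M + (m - a) - 1) (m - a))"
    \<comment> \<open>The terms with \<open>a > M\<close> vanish.\<close>
    by (rule sum.mono_neutral_right) auto
  also have "\<dots> = (\<Sum>a=0..min M m. t ^ (a choose 2) * gauss_binomial t M a
      * gauss_binomial t (M + m - a - 1) (m - a))"
    by (rule sum.cong) auto
  finally show ?thesis .
qed

section \<open>Exponentials and logarithmic derivatives\<close>

lemma fps_exp_compose_unique:
  fixes L P :: "'a :: field_char_0 fps"
  assumes L: "L $ 0 = 0" and P0: "P $ 0 = 1" and P': "fps_deriv P = fps_deriv L * P"
  shows "fps_exp 1 oo L = P"
proof -
  \<comment> \<open>The product of \<open>P\<close> with the exponential of \<open>- L\<close> has derivative 0, so it is the constant 1.\<close>
  let ?E = "fps_exp 1 oo L" and ?E' = "fps_exp (-1) oo L"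
  have *: "?E * ?E' = 1"
  proof -
    have "?E * ?E' = (fps_exp 1 * fps_exp (-1)) oo L"
      by (simp add: fps_compose_mult_distrib L)
    also have "fps_exp 1 * fps_exp (-1) = (1 :: 'a fps)"
      by (simp flip: fps_exp_add_mult)
    finally show ?thesis by simp
  qed
  have dE': "fps_deriv ?E' = - (fps_deriv L * ?E')"
    by (simp add: fps_compose_deriv L fps_compose_uminus mult.commute flip: fps_const_neg)
  have "fps_deriv (P * ?E') = 0"
    by (simp add: dE' P' algebra_simps)
  then have "P * ?E' = fps_const ((P * ?E') $ 0)"
    using fps_deriv_eq_0_iff by blast
  also have "(P * ?E') $ 0 = 1"
    by (simp add: P0)
  finally have "P * (?E * ?E') = ?E"
    by (simp add: mult.left_commute)
  with * show ?thesis by simp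
qed

lemma fps_deriv_prod_log:
  fixes g l :: "'b \<Rightarrow> 'a :: comm_ring_1 fps"
  assumes "finite A" "\<And>i. i \<in> A \<Longrightarrow> fps_deriv (g i) = l i * g i"
  shows "fps_deriv (prod g A) = sum l A * prod g A"
  using assms by (induction A rule: finite_induct) (simp_all add: algebra_simps)

text \<open>
  The logarithmic derivative of \<open>(1 + x u) / (1 - x u)\<close> is \<open>2 x / (1 - x\<^sup>2 u\<^sup>2)\<close>, whose
  expansion has only even powers of \<open>u\<close>.
\<close>

lemma fps_deriv_schur_q_factor:
  fixes x :: "'a :: field_char_0"
  defines "g \<equiv> (1 + fps_const x * fps_X) / (1 - fps_const x * fps_X)"
  shows "fps_deriv g = 2 * Abs_fps (\<lambda>n. if even n then x ^ Suc n else 0) * g"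
proof -
  let ?c = "fps_const x" and ?l = "2 * Abs_fps (\<lambda>n. if even n then x ^ Suc n else 0)"
  let ?p = "1 + ?c * fps_X" and ?d = "1 - ?c * fps_X"
  have geo: "Abs_fps (\<lambda>n. if even n then x ^ Suc n else 0) * (?p * ?d) = ?c"
  proof -
    let ?A = "Abs_fps (\<lambda>n. if even n then x ^ Suc n else 0)"
    \<comment> \<open>The recurrence \<open>A = x + x\<^sup>2 u\<^sup>2 A\<close> is the claim \<open>A (1 - x\<^sup>2 u\<^sup>2) = x\<close>.\<close>
    have "?A = ?c + ?c * (?c * (fps_X ^ 2 * ?A))"
    proof (rule fps_ext)
      fix n
      consider "n = 0" | "n = 1" | k where "n = Suc (Suc k)"
        by (metis One_nat_def not0_implies_Suc)
      then show "?A $ n = (?c + ?c * (?c * (fps_X ^ 2 * ?A))) $ n"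
        by cases (simp_all add: fps_X_power_mult_nth)
    qed
    then have "?A - ?c * (?c * (fps_X ^ 2 * ?A)) = ?c"
      by (metis add_diff_cancel_right')
    then show ?thesis
      by (simp add: algebra_simps power2_eq_square del: fps_const_mult)
  qed
  have gd: "g * ?d = ?p"
    by (simp add: g_def fps_divide_unit inverse_mult_eq_1 mult.assoc)
  have d0: "?d \<noteq> 0"
    by (rule fps_nonzeroI[of _ 0]) simp
  have g': "fps_deriv g * ?d = ?c + g * ?c"
    using arg_cong[OF gd, of fps_deriv] by (simp add: algebra_simps)
  have "(fps_deriv g * ?d) * ?d = ?c * ?d + (g * ?d) * ?c"
    unfolding g' by (simp only: distrib_left distrib_right mult_ac)
  also have "\<dots> = 2 * ?c"
    unfolding gd by (simp add: algebra_simps)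
  also have "\<dots> = ?l * (?p * ?d)"
    using geo by (simp add: mult.assoc)
  also have "\<dots> = (?l * g * ?d) * ?d"
    unfolding gd[symmetric] by (simp add: mult_ac)
  finally show ?thesis
    unfolding mult_right_cancel[OF d0] .
qed

section \<open>The coefficients of the series as Schur \<open>Q\<close>-functions\<close>

lemma F_series_nth_eq_schur_q:
  fixes t :: "'a :: field_char_0"
  assumes t: "\<And>j. j > 0 \<Longrightarrow> t ^ j \<noteq> 1"
  shows "F_series t (t ^ M) $ m = (- 1) ^ m * schur_q m M (\<lambda>i. t ^ (i - 1))"
proof -
  define L where
    "L = Abs_fps (\<lambda>n. if odd n then (1 - (t ^ M) ^ n) / (1 - t ^ n) * (1 / of_nat n) else 0)"
  define g where
    "g = (\<lambda>i. (1 + fps_const (t ^ (i - 1)) * fps_X) / (1 - fps_const (t ^ (i - 1)) * fps_X))"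
  define l where
    "l = (\<lambda>i. 2 * Abs_fps (\<lambda>n. if even n then (t ^ (i - 1)) ^ Suc n else 0))"
  have two: "(2 * f) $ k = 2 * f $ k" for f :: "'a fps" and k
    by (simp add: numeral_fps_const)
  have deriv_L: "fps_deriv (2 * L) = (\<Sum>i=1..M. l i)"
  proof (rule fps_ext)
    fix n
    have sum: "(\<Sum>i=1..M. (t ^ (i - 1)) ^ Suc n) = (1 - (t ^ M) ^ Suc n) / (1 - t ^ Suc n)"
    proof -
      have "(\<Sum>i=1..M. (t ^ (i - 1)) ^ Suc n) = (\<Sum>i<M. (t ^ Suc n) ^ i)"
        by (rule sum.reindex_bij_witness[of _ Suc "\<lambda>i. i - 1"])
          (auto simp: power_mult[symmetric] mult.commute
            simp del: power_Suc mult_Suc mult_Suc_right)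
      also have "\<dots> = (1 - (t ^ Suc n) ^ M) / (1 - t ^ Suc n)"
        using t[of "Suc n"] by (subst sum_gp_strict) simp
      finally show ?thesis by (simp add: mult.commute del: power_Suc mult_Suc mult_Suc_right flip: power_mult)
    qed
    show "fps_deriv (2 * L) $ n = (\<Sum>i=1..M. l i) $ n"
    proof (cases "even n")
      case True
      then have "fps_deriv (2 * L) $ n = 2 * ((1 - (t ^ M) ^ Suc n) / (1 - t ^ Suc n))"
        by (simp add: two L_def del: power_Suc of_nat_Suc)
      also have "\<dots> = (\<Sum>i=1..M. l i) $ n"
        unfolding sum[symmetric] using True
        by (simp add: fps_sum_nth l_def two sum_distrib_left del: power_Suc)
      finally show ?thesis .
    next
      case False
      then show ?thesis
        by (simp add: fps_sum_nth l_def two L_def)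
    qed
  qed
  have "fps_exp 1 oo (2 * L) = prod g {1..M}"
  proof (rule fps_exp_compose_unique)
    show "(2 * L) $ 0 = 0"
      by (simp add: L_def fps_mult_nth)
    show "prod g {1..M} $ 0 = 1"
      by (induction M) (simp_all add: g_def fps_divide_unit)
    show "fps_deriv (prod g {1..M}) = fps_deriv (2 * L) * prod g {1..M}"
      unfolding deriv_L
      by (rule fps_deriv_prod_log) (simp_all only: g_def l_def
          fps_deriv_schur_q_factor finite_atLeastAtMost)
  qed
  \<comment> \<open>\<open>L\<close> has only odd powers, so a change of sign of \<open>L\<close> is the substitution \<open>u \<mapsto> - u\<close>.\<close>
  moreover have "- 2 * L = (2 * L) oo (- fps_X)"
  proof (rule fps_ext)
    fix n
    have "(2 * L) $ n = 0" if "even n"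
      using that unfolding two by (simp add: L_def)
    then show "(- 2 * L) $ n = ((2 * L) oo (- fps_X)) $ n"
      unfolding fps_compose_uminus' by (cases "even n") simp_all
  qed
  moreover have "(2 * L) $ 0 = 0"
    by (simp add: L_def fps_mult_nth)
  ultimately have "F_series t (t ^ M) = prod g {1..M} oo (- fps_X)"
    by (simp add: F_series_def L_def fps_compose_assoc)
  then show ?thesis
    by (simp add: fps_compose_uminus' schur_q_def g_def)
qed

section \<open>Polynomials with nonnegative integer coefficients\<close>

lemma nat_polysI: "(\<And>i. coeff p i \<in> \<nat>) \<Longrightarrow> to_fract p \<in> nat_polys"
  by (auto simp: nat_polys_def)

lemma nat_polysE:
  assumes "x \<in> nat_polys"
  obtains p where "x = to_fract p" "\<And>i. coeff p i \<in> \<nat>"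
  using assms by (auto simp: nat_polys_def)

lemma nat_polys_0: "0 \<in> nat_polys"
  using nat_polysI[of 0] by simp

lemma nat_polys_1: "1 \<in> nat_polys"
  using nat_polysI[of 1] by simp

lemma nat_polys_indet: "indet \<in> nat_polys"
  unfolding indet_def by (rule nat_polysI) simp

lemma nat_polys_add:
  assumes "x \<in> nat_polys" "y \<in> nat_polys"
  shows "x + y \<in> nat_polys"
proof -
  obtain p q where "x = to_fract p" "\<And>i. coeff p i \<in> \<nat>" "y = to_fract q" "\<And>i. coeff q i \<in> \<nat>"
    using assms by (metis nat_polysE)
  then show ?thesis
    using nat_polysI[of "p + q"] by simp
qed

lemma nat_polys_mult:
  assumes "x \<in> nat_polys" "y \<in> nat_polys"
  shows "x * y \<in> nat_polys"
proof -
  obtain p q where pq: "x = to_fract p" "\<And>i. coeff p i \<in> \<nat>" "y = to_fract q" "\<And>i. coeff q i \<in> \<nat>"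
    using assms by (metis nat_polysE)
  have sum_Nats: "sum f A \<in> \<nat>" if "\<And>i. i \<in> A \<Longrightarrow> f i \<in> \<nat>" for f :: "nat \<Rightarrow> rat" and A
    using that by (induction A rule: infinite_finite_induct) simp_all
  have "coeff (p * q) i \<in> \<nat>" for i
    unfolding coeff_mult by (intro sum_Nats Nats_mult pq)
  then show ?thesis
    using nat_polysI[of "p * q"] by (simp add: pq)
qed

lemma nat_polys_power: "p \<in> nat_polys \<Longrightarrow> p ^ n \<in> nat_polys"
  by (induction n) (simp_all add: nat_polys_1 nat_polys_mult)

lemma nat_polys_sum: "(\<And>i. i \<in> A \<Longrightarrow> f i \<in> nat_polys) \<Longrightarrow> sum f A \<in> nat_polys"
  by (induction A rule: infinite_finite_induct) (simp_all add: nat_polys_0 nat_polys_add)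

text \<open>The indeterminate is not a root of unity, so the results above apply to it.\<close>

lemma indet_power_neq_1: "indet ^ n \<noteq> 1" if "n > 0"
proof -
  have "indet ^ n = to_fract (monom 1 n)"
    unfolding indet_def by (induction n) (simp_all add: mult_monom flip: to_fract_mult)
  moreover have "monom (1 :: rat) n \<noteq> 1"
    using that by (metis degree_1 degree_monom_eq not_gr_zero zero_neq_one)
  ultimately show ?thesis
    by (metis to_fract_1 to_fract_eq_iff)
qed

lemma gauss_binomial_in_nat_polys: "gauss_binomial indet n k \<in> nat_polys"
proof (induction n arbitrary: k)
  case 0
  show ?case
    by (cases k) (simp_all add: nat_polys_0 nat_polys_1)
next
  case (Suc n)
  show ?case
    by (cases k) (simp_all add: nat_polys_1 gauss_binomial_pascal indet_power_neq_1
        nat_polys_add nat_polys_mult nat_polys_power nat_polys_indet Suc.IH)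
qed

section \<open>Formula and positivity\<close>

theorem proposition4p2:
  fixes M m :: nat
  assumes "M \<ge> 1"
  shows "f_coeff M m = (- 1) ^ m * schur_q m M (\<lambda>i. indet ^ (i - 1))
     \<and> (- 1) ^ m * f_coeff M m \<in> nat_polys
     \<and> (- 1) ^ m * f_coeff M m =
           (\<Sum>a=0..min M m. indet ^ (a choose 2) * gauss_binomial indet M a
              * gauss_binomial indet (M + m - a - 1) (m - a))"
proof -
  have q: "f_coeff M m = (- 1) ^ m * schur_q m M (\<lambda>i. indet ^ (i - 1))"
    unfolding f_coeff_def using indet_power_neq_1 by (rule F_series_nth_eq_schur_q)
  have "(- 1) ^ m * f_coeff M m = schur_q m M (\<lambda>i. indet ^ (i - 1))"
    using q by (cases "even m") simp_all
  then have formula: "(- 1) ^ m * f_coeff M m =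
      (\<Sum>a=0..min M m. indet ^ (a choose 2) * gauss_binomial indet M a
         * gauss_binomial indet (M + m - a - 1) (m - a))"
    using schur_q_geometric[OF indet_power_neq_1] by simp
  have "(- 1) ^ m * f_coeff M m \<in> nat_polys"
    unfolding formula
    by (intro nat_polys_sum nat_polys_mult nat_polys_power nat_polys_indet gauss_binomial_in_nat_polys)
  with q formula show ?thesis by simp
qed

end
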